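(* Let $\omega$ be a one-form on $\mathbb T^2$ as described in the context, let $\Omega=\Pi^\ast\omega$ be its pullback to $\mathbb R^2$, and let $$Z(x,y)=\int_{(0,0)}^{(x,y)}\Omega,\qquad (x,y)\in\mathbb R^2 .$$ Then $Z:\mathbb R^2\to\mathbb C$ is a global homeomorphism (of $\mathbb R^2$ onto $\mathbb C$).
   Context: Setting. Let $\mathbb T^2=\mathbb R^2/\mathbb Z^2$ with coordinates $(x,y)$ and covering map $\Pi:\mathbb R^2\to\mathbb T^2$. Let $\omega=a\,dx+b\,dy$ be a nowhere vanishing closed complex-valued one-form on $\mathbb T^2$ with $a,b\in C^{1+\varepsilon}(\mathbb T^2;\mathbb C)$, $\varepsilon>0$, such that: (a) the set $\Sigma=\{p\in\mathbb T^2:\ \omega(p)\wedge\overline{\omega(p)}=0\}$ is a one-dimensional (embedded) manifold, with connected components $\Sigma_1,\dots,\Sigma_N$; (b) for each $i$ there is a number $\sigma_i>0$ such that every $p\in\Sigma_i$ has a neighborhood in which $\omega\wedge\overline\omega=|\rho_i|^{\sigma_i}g\,dx\wedge dy$, where $\rho_i$ is a (real-valued) defining function of $\Sigma_i$ near $p$ and $g$ is a non-vanishing continuous function; (c) $\omega$ is hypocomplex: every $p\in\mathbb T^2$ has an open neighborhood $U$ with a first integral $\zeta\in C^{1+\varepsilon}(U;\mathbb C)$ (that is, $d\zeta\neq0$ and $d\zeta\wedge\omega=0$ on $U$) such that $\zeta:U\to\zeta(U)\subset\mathbb C$ is a homeomorphism. Since $\Omega$ is closed on $\mathbb R^2$,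 the integral defining $Z$ is independent of the path. *)

theory Defs
  imports "HOL-Analysis.Analysis"
begin

section \<open>The torus \<open>\<real>\<^sup>2 / \<int>\<^sup>2\<close>\<close>

definition lattice_rel :: "real \<times> real \<Rightarrow> real \<times> real \<Rightarrow> bool" where
  "lattice_rel p q \<longleftrightarrow> p - q \<in> \<int> \<times> \<int>"

lemma equivp_lattice_rel: "equivp lattice_rel"
proof (rule equivpI)
  show "reflp lattice_rel"
    by (auto simp: reflp_def lattice_rel_def zero_prod_def)
  show "symp lattice_rel"
  proof (rule sympI)
    fix p q assume "lattice_rel p q"
    then have "fst p - fst q \<in> \<int>" "snd p - snd q \<in> \<int>"
      by (auto simp: lattice_rel_def mem_Times_iff)
    then have "- (fst p - fst q) \<in> \<int>" "- (snd p - snd q) \<in> \<int>"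
      by (simp_all only: Ints_minus)
    then show "lattice_rel q p"
      by (simp add: lattice_rel_def mem_Times_iff)
  qed
  show "transp lattice_rel"
  proof (rule transpI)
    fix p q r assume "lattice_rel p q" "lattice_rel q r"
    then have "fst p - fst q \<in> \<int>" "fst q - fst r \<in> \<int>" "snd p - snd q \<in> \<int>" "snd q - snd r \<in> \<int>"
      by (auto simp: lattice_rel_def mem_Times_iff)
    from Ints_add[OF this(1,2)] Ints_add[OF this(3,4)]
    show "lattice_rel p r"
      by (simp add: lattice_rel_def mem_Times_iff)
  qed
qed

quotient_type torus = "real \<times> real" / lattice_rel
  by (rule equivp_lattice_rel)

definition covering_proj :: "real \<times> real \<Rightarrow> torus" (\<open>\<Pi>\<close>) where
  "\<Pi> = abs_torus"

text \<open>The quotient topology.\<close>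

instantiation torus :: topological_space
begin

definition open_torus :: "torus set \<Rightarrow> bool" where
  "open_torus U \<longleftrightarrow> open (\<Pi> -` U)"

instance
proof
  show "open (UNIV :: torus set)"
    by (simp add: open_torus_def)
  show "open (S \<inter> T)" if "open S" "open T" for S T :: "torus set"
    using that by (simp add: open_torus_def vimage_Int open_Int)
  show "open (\<Union>K)" if "\<forall>S\<in>K. open S" for K :: "torus set set"
    using that by (auto simp: open_torus_def vimage_Union)
qed

end

section \<open>Regularity classes\<close>

definition partial_x :: "(real \<times> real \<Rightarrow> 'b::real_normed_vector) \<Rightarrow> real \<times> real \<Rightarrow> 'b" where
  "partial_x f q = frechet_derivative f (at q) (1, 0)"

definition partial_y :: "(real \<times> real \<Rightarrow> 'b::real_normed_vector) \<Rightarrow> real \<times> real \<Rightarrow> 'b" where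
  "partial_y f q = frechet_derivative f (at q) (0, 1)"

text \<open>The Hoelder condition is local. On a compact manifold this agrees with the uniform condition.
  For exponent 0 it is implied by continuity, so \<open>Ck_holder k 0\<close> is the classical \<open>C\<^sup>k\<close>.\<close>

definition locally_holder ::
    "real \<Rightarrow> (real \<times> real) set \<Rightarrow> (real \<times> real \<Rightarrow> 'b::real_normed_vector) \<Rightarrow> bool" where
  "locally_holder \<alpha> U f \<longleftrightarrow>
     (\<forall>p\<in>U. \<exists>V C. open V \<and> p \<in> V \<and>
        (\<forall>q\<in>V \<inter> U. \<forall>r\<in>V \<inter> U. norm (f q - f r) \<le> C * dist q r powr \<alpha>))"

fun Ck_holder ::
    "nat \<Rightarrow> real \<Rightarrow> (real \<times> real) set \<Rightarrow> (real \<times> real \<Rightarrow> 'b::real_normed_vector) \<Rightarrow> bool" where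
  "Ck_holder 0 \<alpha> U f \<longleftrightarrow> continuous_on U f \<and> locally_holder \<alpha> U f"
| "Ck_holder (Suc k) \<alpha> U f \<longleftrightarrow>
     (\<forall>q\<in>U. f differentiable (at q)) \<and>
     Ck_holder k \<alpha> U (partial_x f) \<and> Ck_holder k \<alpha> U (partial_y f)"

text \<open>\<open>C\<^sup>s(U)\<close> for real \<open>s \<ge> 0\<close> and open \<open>U \<subseteq> \<T>\<^sup>2\<close>: the integer part of \<open>s\<close> counts the
  derivatives, the fractional part is the Hoelder exponent. Since \<open>\<Pi>\<close> is a local diffeomorphism,
  regularity of \<open>f\<close> is regularity of its periodic lift.\<close>

definition C_torus :: "real \<Rightarrow> torus set \<Rightarrow> (torus \<Rightarrow> 'b::real_normed_vector) \<Rightarrow> bool" where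
  "C_torus s U f \<longleftrightarrow> Ck_holder (nat \<lfloor>s\<rfloor>) (frac s) (\<Pi> -` U) (f \<circ> \<Pi>)"

section \<open>Complex one-forms\<close>

text \<open>The form \<open>a dx + b dy\<close> is represented by the function \<open>p \<mapsto> (a p, b p)\<close>; a two-form
  \<open>c dx \<and> dy\<close> by its coefficient \<open>c\<close>. As \<open>\<Pi>\<^sup>* dx = dx\<close> and \<open>\<Pi>\<^sup>* dy = dy\<close>, pulling back to the
  plane is composition with \<open>\<Pi>\<close>.\<close>

type_synonym 'p one_form = "'p \<Rightarrow> complex \<times> complex"

definition pullback :: "torus one_form \<Rightarrow> (real \<times> real) one_form" where
  "pullback \<omega> = \<omega> \<circ> \<Pi>"

definition wedge :: "complex \<times> complex \<Rightarrow> complex \<times> complex \<Rightarrow> complex" where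
  "wedge v w = fst v * snd w - snd v * fst w"

definition conj_form :: "complex \<times> complex \<Rightarrow> complex \<times> complex" where
  "conj_form v = (cnj (fst v), cnj (snd v))"

definition differential :: "(real \<times> real \<Rightarrow> complex) \<Rightarrow> (real \<times> real) one_form" where
  "differential f q = (partial_x f q, partial_y f q)"

definition closed_form :: "(real \<times> real) one_form \<Rightarrow> bool" where
  "closed_form \<Omega> \<longleftrightarrow> (\<forall>q. partial_x (\<lambda>r. snd (\<Omega> r)) q = partial_y (\<lambda>r. fst (\<Omega> r)) q)"

definition line_integral :: "(real \<times> real) one_form \<Rightarrow> (real \<Rightarrow> real \<times> real) \<Rightarrow> complex" where
  "line_integral \<Omega> \<gamma> =
     integral {0..1} (\<lambda>t. let v = vector_derivative \<gamma> (at t within {0..1})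
        in fst (\<Omega> (\<gamma> t)) * of_real (fst v) + snd (\<Omega> (\<gamma> t)) * of_real (snd v))"

text \<open>For closed \<open>\<Omega>\<close> the integral is independent of the path, so the segment from the origin may
  be used.\<close>

definition primitive :: "(real \<times> real) one_form \<Rightarrow> real \<times> real \<Rightarrow> complex" where
  "primitive \<Omega> q = line_integral \<Omega> (linepath (0, 0) q)"

section \<open>The degeneracy set and hypocomplexity\<close>

definition degeneracy_set :: "torus one_form \<Rightarrow> torus set" where
  "degeneracy_set \<omega> = {p. wedge (\<omega> p) (conj_form (\<omega> p)) = 0}"

text \<open>Embedded \<open>C\<^sup>1\<close> curves, by slice charts: by the inverse function theorem an injective \<open>C\<^sup>1\<close>
  map \<open>\<phi>\<close> with invertible derivatives is a diffeomorphism onto an open set. The empty set is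
  allowed.\<close>

definition embedded_curve :: "torus set \<Rightarrow> bool" where
  "embedded_curve S \<longleftrightarrow>
     (\<forall>p\<in>S. \<exists>V. \<exists>\<phi> :: torus \<Rightarrow> real \<times> real.
        open V \<and> p \<in> V \<and> C_torus 1 V \<phi> \<and> inj_on \<phi> V \<and>
        (\<forall>q. \<Pi> q \<in> V \<longrightarrow> bij (frechet_derivative (\<phi> \<circ> \<Pi>) (at q))) \<and>
        V \<inter> S = {q \<in> V. snd (\<phi> q) = 0})"

definition defining_function :: "torus set \<Rightarrow> torus set \<Rightarrow> (torus \<Rightarrow> real) \<Rightarrow> bool" where
  "defining_function S V \<rho> \<longleftrightarrow>
     C_torus 1 V \<rho> \<and> V \<inter> S = {q \<in> V. \<rho> q = 0} \<and>
     (\<forall>q. \<Pi> q \<in> V \<inter> S \<longrightarrow> (partial_x (\<rho> \<circ> \<Pi>) q, partial_y (\<rho> \<circ> \<Pi>) q) \<noteq> (0, 0))"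

definition vanishes_to_order :: "torus one_form \<Rightarrow> torus set \<Rightarrow> real \<Rightarrow> bool" where
  "vanishes_to_order \<omega> S \<sigma> \<longleftrightarrow>
     (\<forall>p\<in>S. \<exists>V. \<exists>\<rho> :: torus \<Rightarrow> real. \<exists>g :: torus \<Rightarrow> complex.
        open V \<and> p \<in> V \<and> defining_function S V \<rho> \<and>
        continuous_on V g \<and> (\<forall>q\<in>V. g q \<noteq> 0) \<and>
        (\<forall>q\<in>V. wedge (\<omega> q) (conj_form (\<omega> q)) = of_real (\<bar>\<rho> q\<bar> powr \<sigma>) * g q))"

definition first_integral :: "real \<Rightarrow> torus one_form \<Rightarrow> torus set \<Rightarrow> (torus \<Rightarrow> complex) \<Rightarrow> bool" where
  "first_integral s \<omega> U \<zeta> \<longleftrightarrow>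
     C_torus s U \<zeta> \<and>
     (\<forall>q. \<Pi> q \<in> U \<longrightarrow>
        differential (\<zeta> \<circ> \<Pi>) q \<noteq> (0, 0) \<and> wedge (differential (\<zeta> \<circ> \<Pi>) q) (pullback \<omega> q) = 0)"

definition hypocomplex :: "real \<Rightarrow> torus one_form \<Rightarrow> bool" where
  "hypocomplex s \<omega> \<longleftrightarrow>
     (\<forall>p. \<exists>U \<zeta>. open U \<and> p \<in> U \<and> first_integral s \<omega> U \<zeta> \<and>
        (\<exists>\<xi>. homeomorphism U (\<zeta> ` U) \<zeta> \<xi>))"

end

(* Near every point the primitive Z and a first integral zeta satisfy dZ = lambda dzeta with a continuous
   non-vanishing lambda. In the coordinates (Re zeta, y), zeta moves monotonically along the vertical lines
   and at unit real speed along the horizontal ones, so any increment of Z is close to lambda times the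
   increment of zeta, even where dzeta has real rank 1. Hence Z is locally injective, and a local
   homeomorphism by invariance of domain. The lattice translations change Z by constants, so compactness
   of the torus makes the radii of these local homeomorphisms uniform. Therefore Z is a covering map onto
   the simply connected plane, and so a homeomorphism. *)

theory Submission
  imports Defs
begin

text \<open>The obstacle is the degeneracy set: there \<zeta> has real rank 1, so the inverse
  function theorem says nothing about Z. Integrating dZ - \<lambda>(p) d\<zeta> along an arbitrary
  path does not help either, because the \<zeta>-image of the path may be much longer than the
  increment of \<zeta> between its ends. What is needed is a path whose \<zeta>-image has length
  comparable to that increment. The L-shaped path in the coordinates (Re \<zeta>, y) has this
  property. On its vertical leg Re \<zeta> is constant, so injectivity of \<zeta> forces Im \<zeta>
  to be strictly monotone, and the image is a segment run through once, without backtracking. After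
  normalisation the whole image is at most 7 times as long as the increment of \<zeta>, so \<lambda>
  within 1/14 of its value at p leaves an error of at most half that increment. This real-variable
  estimate takes the place of a factorisation of Z through \<zeta> by a holomorphic function, and it
  asks only for continuity of \<lambda>.\<close>

section \<open>Covering maps from uniform local homeomorphisms\<close>

text \<open>Because \<rho> does not depend on the point, the range is closed as well as open, hence
  everything, and each ball of radius \<rho> is evenly covered by pieces of the balls of radius
  \<open>r\<close> around the preimages of its centre. Injectivity is asked on radius
  \<open>2 * r\<close> because overlapping pieces have centres at distance less than
  \<open>2 * r\<close>.\<close>

lemma covering_space_uniform_local_homeo:
  fixes f :: "'a::euclidean_space \<Rightarrow> 'b::euclidean_space"
  assumes cont: "continuous_on UNIV f" and dim: "DIM('b) \<le> DIM('a)"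
    and r: "r > 0" "\<And>q. inj_on f (ball q (2 * r))"
    and \<rho>: "\<rho> > 0" "\<And>q. ball (f q) \<rho> \<subseteq> f ` ball q r"
  shows "covering_space UNIV f UNIV"
proof
  have inj: "q = q'" if "dist q q' < 2 * r" "f q = f q'" for q q'
    using inj_onD[OF r(2)[of q] that(2)] r(1) that(1) by simp
  show "range f = UNIV"
  proof (rule ccontr)
    assume "range f \<noteq> UNIV"
    have "open (range f)"
      using \<rho> by (force simp: open_contains_ball)
    moreover have "closed (range f)"
    proof (subst closed_def, subst open_contains_ball, safe)
      fix w assume w: "w \<notin> range f"
      \<comment> \<open>A value \<open>f q\<close> closer than \<rho> to \<open>w\<close> would put
        \<open>w\<close> into the image of \<open>ball q r\<close>.\<close>
      have "ball w \<rho> \<subseteq> - range f"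
      proof (safe)
        fix q assume "f q \<in> ball w \<rho>"
        then show False using \<rho>(2)[of q] w by (auto simp: dist_commute)
      qed
      then show "\<exists>e>0. ball w e \<subseteq> - range f" using \<rho>(1) by blast
    qed
    ultimately show False
      using \<open>range f \<noteq> UNIV\<close> clopen[of "range f"] by auto
  qed
  fix w :: 'b
  define sheet where "sheet q = ball q r \<inter> f -` ball w \<rho>" for q
  have opn: "open (sheet q)" for q
    unfolding sheet_def using cont by (intro open_Int open_vimage) auto
  have "\<Union>(sheet ` (f -` {w})) = f -` ball w \<rho>"
  proof
    show "f -` ball w \<rho> \<subseteq> \<Union>(sheet ` (f -` {w}))"
    proof
      fix p assume p: "p \<in> f -` ball w \<rho>"
      \<comment> \<open>The ball of radius \<rho> around \<open>f p\<close> contains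
        \<open>w\<close>, so \<open>w\<close> has a preimage within \<open>r\<close> of
        \<open>p\<close>, and \<open>p\<close> lies on the sheet around that preimage.\<close>
      then have "w \<in> f ` ball p r" using \<rho>(2)[of p] by (auto simp: dist_commute)
      then obtain q where "q \<in> ball p r" "f q = w" by auto
      with p show "p \<in> \<Union>(sheet ` (f -` {w}))"
        by (auto simp: sheet_def dist_commute intro!: bexI[of _ q])
    qed
  qed (auto simp: sheet_def)
  moreover have "pairwise disjnt (sheet ` (f -` {w}))"
  proof (clarsimp simp: pairwise_def disjnt_def)
    fix q q' assume *: "w = f q" "f q' = f q" "sheet q \<noteq> sheet q'"
    show "sheet q \<inter> sheet q' = {}"
    proof (rule ccontr)
      assume "sheet q \<inter> sheet q' \<noteq> {}"
      then obtain p where "dist q p < r" "dist q' p < r" unfolding sheet_def by auto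
      then have "dist q q' < 2 * r" using dist_triangle2[of q q' p] by simp
      from inj[OF this *(2)[symmetric]] *(3) show False by simp
    qed
  qed
  moreover have "\<exists>g. homeomorphism (sheet q) (ball w \<rho>) f g" if q: "f q = w" for q
  proof -
    have inj: "inj_on f (sheet q)"
      using r by (intro inj_on_subset[OF r(2)[of q]]) (auto simp: sheet_def)
    have img: "f ` sheet q = ball w \<rho>"
      using \<rho>(2)[of q] unfolding q sheet_def by blast
    have open_img: "open (f ` T)" if "openin (top_of_set (sheet q)) T" for T
    proof (rule invariance_of_domain_gen[OF _ _ _ dim])
      show "open T" using that opn[of q] by (simp add: openin_open_eq)
      show "continuous_on T f" by (rule continuous_on_subset[OF cont]) simp
      show "inj_on f T" using inj_on_subset[OF inj openin_imp_subset[OF that]] .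
    qed
    show ?thesis
    proof (rule homeomorphism_injective_open_map[OF _ img inj])
      show "continuous_on (sheet q) f" by (rule continuous_on_subset[OF cont]) auto
      show "openin (top_of_set (ball w \<rho>)) (f ` T)" if "openin (top_of_set (sheet q)) T" for T
        using open_img[OF that] img openin_imp_subset[OF that] by (auto simp: openin_open_eq)
    qed metis
  qed
  ultimately show "\<exists>T. w \<in> T \<and> openin (top_of_set UNIV) T \<and>
                    (\<exists>v. \<Union>v = UNIV \<inter> f -` T \<and> (\<forall>u \<in> v. openin (top_of_set UNIV) u) \<and>
                    pairwise disjnt v \<and> (\<forall>u \<in> v. \<exists>q. homeomorphism u T f q))"
    using \<rho>(1) opn
    by (intro exI[of _ "ball w \<rho>"] conjI exI[of _ "sheet ` (f -` {w})"]) auto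
qed (rule cont)

text \<open>The target is simply connected, so its identity map lifts to a section \<open>g\<close>
  through 0. Then \<open>g\<close> after \<open>p\<close> and the identity of the source are two
  lifts of \<open>p\<close> that agree at 0, so uniqueness of lifts makes \<open>g\<close> a
  two-sided inverse.\<close>

lemma covering_space_UNIV_imp_homeomorphism:
  fixes p :: "'a::real_normed_vector \<Rightarrow> 'b::real_normed_vector"
  assumes cov: "covering_space UNIV p UNIV"
  shows "\<exists>g. homeomorphism UNIV UNIV p g"
proof -
  have cont: "continuous_on UNIV p" using cov by (rule covering_space_imp_continuous)
  obtain g where g: "continuous_on UNIV g" "g (p 0) = 0" "\<And>y. p (g y) = y"
  proof (rule covering_space_lift_strong[OF cov, of 0 "p 0" UNIV "\<lambda>y. y"])
    show "simply_connected (UNIV :: 'b set)" by (simp add: convex_imp_simply_connected)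
    show "locally path_connected (UNIV :: 'b set)" by (simp add: convex_imp_locally_path_connected)
  qed (use that in auto)
  have "g (p x) = x" for x
  proof (rule covering_space_lift_unique[OF cov, of "\<lambda>x. g (p x)" 0 "\<lambda>x. x" UNIV p])
    show "continuous_on UNIV (\<lambda>x. g (p x))"
      using continuous_on_compose2[OF g(1) cont] by simp
  qed (use g cont in auto)
  then show ?thesis
    using g cont by (intro exI[of _ g]) (auto simp: homeomorphism_def surj_def; metis)
qed

text \<open>A Lebesgue number argument. It serves twice: for the radius on which \<open>f\<close> is
  injective, and for the radius of a ball contained in the image of a fixed ball.\<close>

lemma compact_uniform_radius:
  fixes P :: "'a::metric_space \<Rightarrow> real \<Rightarrow> bool"
  assumes "compact K"
    and local: "\<And>p. p \<in> K \<Longrightarrow> \<exists>N e. open N \<and> p \<in> N \<and> e > 0 \<and> (\<forall>q\<in>N. P q e)"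
    and anti: "\<And>q d e. 0 < d \<Longrightarrow> d \<le> e \<Longrightarrow> P q e \<Longrightarrow> P q d"
  obtains e where "e > 0" "\<And>q. q \<in> K \<Longrightarrow> P q e"
proof -
  obtain N e where Ne: "\<And>p. p \<in> K \<Longrightarrow> open (N p) \<and> p \<in> N p \<and> e p > 0 \<and> (\<forall>q\<in>N p. P q (e p))"
    using local by metis
  obtain F where F: "F \<subseteq> K" "finite F" "K \<subseteq> \<Union>(N ` F)"
    using compactE_image[OF \<open>compact K\<close>, of K N] Ne by (metis UN_I subsetI)
  \<comment> \<open>The inserted 1 keeps the minimum meaningful when the finite subcover is
    empty.\<close>
  define d where "d = Min (insert 1 (e ` F))"
  have "d > 0" using F Ne by (auto simp: d_def)
  moreover have "P q d" if q: "q \<in> K" for q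
  proof -
    obtain p where p: "p \<in> F" "q \<in> N p" 
      using UN_E[OF subsetD[OF F(3) q]] by metis
    have "d \<le> e p" unfolding d_def using p(1) F(2) by (intro Min_le) auto
    moreover have "P q (e p)" using Ne[OF subsetD[OF F(1) p(1)]] p(2) by metis
    ultimately show ?thesis using anti[OF \<open>d > 0\<close>] by metis
  qed
  ultimately show ?thesis using that by blast
qed

text \<open>The closed unit square meets every orbit of the lattice. A lattice translation changes
  \<open>f\<close> only by a translation of the plane, an isometry on both sides, so radii found on
  the square are valid at every point.\<close>

lemma quasiperiodic_local_homeo_imp_homeomorphism:
  fixes f :: "real \<times> real \<Rightarrow> complex"
  assumes cont: "continuous_on UNIV f"
    and loc: "\<And>p. \<exists>V. open V \<and> p \<in> V \<and> inj_on f V"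
    and per: "\<And>m n :: int. \<exists>c. \<forall>q. f (q + (of_int m, of_int n)) = f q + c"
  shows "\<exists>g. homeomorphism UNIV UNIV f g"
proof -
  define K :: "(real \<times> real) set" where "K = cbox (0,0) (1,1)"
  have "compact K" by (simp add: K_def compact_cbox)
  have transl: "\<exists>m n :: int. \<exists>q'\<in>K. q = q' + (of_int m, of_int n)" for q :: "real \<times> real"
    by (intro exI[of _ "\<lfloor>fst q\<rfloor>"] exI[of _ "\<lfloor>snd q\<rfloor>"]
          bexI[of _ "(frac (fst q), frac (snd q))"])
      (auto simp: K_def frac_def prod_eq_iff cbox_Pair_eq; linarith)+
  have open_map: "open (f ` V)" if "open V" for V
  proof (subst open_subopen, safe)
    fix p assume "p \<in> V"
    obtain W where W: "open W" "p \<in> W" "inj_on f W" using loc by blast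
    have "open (f ` (V \<inter> W))"
      using W that by (intro invariance_of_domain_gen)
        (auto intro: continuous_on_subset[OF cont] inj_on_subset)
    then show "\<exists>T. open T \<and> f p \<in> T \<and> T \<subseteq> f ` V"
      using \<open>p \<in> V\<close> W by blast
  qed
  have image_ball: "f ` ball (q + (of_int m, of_int n)) r = (\<lambda>z. z + c) ` f ` ball q r"
    if "\<forall>q. f (q + (of_int m, of_int n)) = f q + c" for q m n c r
  proof -
    have "ball (q + (of_int m, of_int n)) r = (\<lambda>q. q + (of_int m, of_int n)) ` ball q r"
      using ball_translation[of "(of_int m, of_int n)" q r] by (simp add: add.commute)
    then show ?thesis using that by (simp only: image_image)
  qed
  obtain e where e: "e > 0" "\<And>q. q \<in> K \<Longrightarrow> inj_on f (ball q e)"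
  proof (rule compact_uniform_radius[OF \<open>compact K\<close>, of "\<lambda>q e. inj_on f (ball q e)"])
    fix p
    obtain V where V: "open V" "p \<in> V" "inj_on f V" using loc by blast
    then obtain d where d: "d > 0" "ball p d \<subseteq> V" by (meson open_contains_ball)
    have "inj_on f (ball q (d/2))" if q: "q \<in> ball p (d/2)" for q
    proof (rule inj_on_subset[OF V(3)])
      have "ball q (d/2) \<subseteq> ball p d"
        using q by (simp add: ball_subset_ball_iff dist_commute)
      with d(2) show "ball q (d/2) \<subseteq> V" by blast
    qed
    then show "\<exists>N e. open N \<and> p \<in> N \<and> e > 0 \<and> (\<forall>q\<in>N. inj_on f (ball q e))"
      using d(1) by (intro exI[of _ "ball p (d/2)"] exI[of _ "d/2"]) auto
  qed (auto intro: inj_on_subset)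
  define r where "r = e / 2"
  have r: "r > 0" "2 * r = e" using e by (auto simp: r_def)
  obtain \<rho> where \<rho>: "\<rho> > 0" "\<And>q. q \<in> K \<Longrightarrow> ball (f q) \<rho> \<subseteq> f ` ball q r"
  proof (rule compact_uniform_radius[OF \<open>compact K\<close>, of "\<lambda>q \<rho>. ball (f q) \<rho> \<subseteq> f ` ball q r"])
    fix p
    have "open (f ` ball p (r/2))" by (intro open_map) auto
    moreover have "f p \<in> f ` ball p (r/2)" using r by auto
    ultimately obtain d where d: "d > 0" "ball (f p) d \<subseteq> f ` ball p (r/2)"
      by (meson open_contains_ball)
    \<comment> \<open>Both halvings leave room to move the centre: for \<open>q\<close> in
      \<open>N\<close>, the ball of radius \<open>d/2\<close> at \<open>f q\<close> stays in the
      ball of radius \<open>d\<close> at \<open>f p\<close>, and the ball of radius \<open>r\<close>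
      at \<open>q\<close> contains the ball of radius \<open>r/2\<close> at
      \<open>p\<close>.\<close>
    define N where "N = ball p (r/2) \<inter> f -` ball (f p) (d/2)"
    have "open N" unfolding N_def using cont by (intro open_Int open_vimage) auto
    moreover have "ball (f q) (d/2) \<subseteq> f ` ball q r" if "q \<in> N" for q
    proof -
      have "ball (f q) (d/2) \<subseteq> ball (f p) d"
        using that unfolding N_def by (simp add: ball_subset_ball_iff dist_commute)
      moreover have "ball p (r/2) \<subseteq> ball q r"
        using that unfolding N_def by (simp add: ball_subset_ball_iff dist_commute)
      ultimately show ?thesis using d by (meson image_mono order_trans)
    qed
    ultimately show "\<exists>N e. open N \<and> p \<in> N \<and> e > 0 \<and> (\<forall>q\<in>N. ball (f q) e \<subseteq> f ` ball q r)"
      using d r by (intro exI[of _ N] exI[of _ "d/2"]) (auto simp: N_def)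
  next
    fix q d e assume "d \<le> e" "ball (f q) e \<subseteq> f ` ball q r"
    then show "ball (f q) d \<subseteq> f ` ball q r" by (meson subset_ball order_trans)
  qed (use that in blast)
  have "covering_space UNIV f UNIV"
  proof (rule covering_space_uniform_local_homeo[OF cont _ r(1) _ \<rho>(1)])
    fix q
    obtain m n :: int and q' where q': "q' \<in> K" "q = q' + (of_int m, of_int n)" using transl by metis
    obtain c where c: "\<forall>q. f (q + (of_int m, of_int n)) = f q + c" using per by blast
    show "inj_on f (ball q (2 * r))"
    proof (rule inj_onI)
      fix x y assume "x \<in> ball q (2 * r)" "y \<in> ball q (2 * r)" "f x = f y"
      moreover define x' y' where "x' = x - (of_int m, of_int n)" and "y' = y - (of_int m, of_int n)"
      ultimately have "x' \<in> ball q' e" "y' \<in> ball q' e" "f x' = f y'"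
        using q' r(2) c[rule_format, of x'] c[rule_format, of y'] 
        by (auto simp: dist_norm algebra_simps)
      then have "x' = y'" using inj_onD[OF e(2)[OF q'(1)]] by metis
      then show "x = y" by (simp add: x'_def y'_def)
    qed
    have "ball (f q) \<rho> = (\<lambda>z. z + c) ` ball (f q') \<rho>"
      using ball_translation[of c "f q'" \<rho>] c[rule_format, of q'] q'(2) by (simp add: add.commute)
    also have "\<dots> \<subseteq> f ` ball q r"
      using image_mono[OF \<rho>(2)[OF q'(1)], of "\<lambda>z. z + c"] image_ball[OF c] q'(2) by simp
    finally show "ball (f q) \<rho> \<subseteq> f ` ball q r" .
  qed simp
  then show ?thesis by (rule covering_space_UNIV_imp_homeomorphism)
qed

section \<open>Local injectivity for proportional differentials\<close>

lemma vector_derivative_bound: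
  fixes f :: "real \<Rightarrow> 'b::real_normed_vector"
  assumes "convex S" and "\<And>t. t \<in> S \<Longrightarrow> (f has_vector_derivative f' t) (at t)"
    and "\<And>t. t \<in> S \<Longrightarrow> norm (f' t) \<le> K" and "x \<in> S" "y \<in> S"
  shows "norm (f x - f y) \<le> K * \<bar>x - y\<bar>"
proof -
  have "norm (f x - f y) \<le> K * norm (x - y)"
  proof (rule differentiable_bound[OF assms(1) _ _ assms(4,5)])
    fix t assume t: "t \<in> S"
    show "(f has_derivative (\<lambda>h. h *\<^sub>R f' t)) (at t within S)"
      using assms(2)[OF t] by (simp add: has_vector_derivative_def has_derivative_at_withinI)
    have "norm (h *\<^sub>R f' t) \<le> K * norm h" for h
      using mult_right_mono[OF assms(3)[OF t], of "\<bar>h\<bar>"] by (simp add: mult.commute)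
    then show "onorm (\<lambda>h. h *\<^sub>R f' t) \<le> K"
      by (intro onorm_le) auto
  qed
  then show ?thesis by simp
qed

text \<open>An injective continuous function on an interval is strictly monotone, so
  \<open>v'\<close> keeps one sign and the total variation of \<open>v\<close> is its increment.
  Thus \<open>K * v\<close> or its negative majorises \<open>g\<close>, even if \<open>v'\<close>
  has zeros.\<close>

lemma monotone_vector_derivative_bound:
  fixes g :: "real \<Rightarrow> 'b::real_normed_vector" and v :: "real \<Rightarrow> real"
  assumes S: "is_interval S" "open S" and inj: "inj_on v S"
    and v: "\<And>t. t \<in> S \<Longrightarrow> (v has_real_derivative v' t) (at t)"
    and g: "\<And>t. t \<in> S \<Longrightarrow> (g has_vector_derivative g' t) (at t)"
    and bound: "\<And>t. t \<in> S \<Longrightarrow> norm (g' t) \<le> K * \<bar>v' t\<bar>"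
    and xy: "x \<in> S" "y \<in> S"
  shows "norm (g x - g y) \<le> K * \<bar>v x - v y\<bar>"
proof -
  have cont: "continuous_on S v"
    using v by (auto intro!: continuous_at_imp_continuous_on DERIV_isCont)
  have *: "norm (g b - g a) \<le> K * \<bar>v b - v a\<bar>" if ab: "a < b" "a \<in> S" "b \<in> S" for a b
  proof -
    have sub: "{a..b} \<subseteq> S" 
      using mem_is_interval_1_I[OF S(1) ab(2,3)] by auto
    have cg: "continuous_on {a..b} g"
      using g sub by (intro continuous_at_imp_continuous_on)
        (meson has_vector_derivative_continuous subsetD)
    have mem: "t \<in> S" if "a < t" "t < b" for t using sub that by auto
    consider "strict_mono_on S v" | "strict_antimono_on S v"
      using injective_eq_monotone_map[OF S(1) cont] inj by blast
    then show ?thesis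
    proof cases
      case 1
      then have m: "mono_on S v" by (simp add: strict_mono_on_imp_mono_on)
      have nn: "v' t \<ge> 0" if "t \<in> S" for t
        using mono_on_imp_deriv_nonneg[OF m v[OF that]] that S(2) by (simp add: interior_open)
      have "norm (g b - g a) \<le> K * v b - K * v a"
      proof (rule differentiable_bound_general[OF ab(1) cg])
        show "continuous_on {a..b} (\<lambda>t. K * v t)"
          by (intro continuous_intros continuous_on_subset[OF cont sub])
        show "(g has_vector_derivative g' t) (at t)" if "a < t" "t < b" for t
          using g mem that by auto
        show "((\<lambda>t. K * v t) has_vector_derivative K * v' t) (at t)" if "a < t" "t < b" for t
          using v[OF mem[OF that]]
          by (auto simp flip: has_real_derivative_iff_has_vector_derivative intro!: derivative_eq_intros)
        show "norm (g' t) \<le> K * v' t" if "a < t" "t < b" for t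
          using bound[OF mem[OF that]] nn[OF mem[OF that]] by simp
      qed
      moreover have "v a \<le> v b" using m ab by (auto dest: mono_onD)
      ultimately show ?thesis by (simp add: right_diff_distrib)
    next
      case 2
      then have m: "mono_on S (\<lambda>t. - v t)"
        by (auto simp: monotone_on_def le_less)
      have nn: "- v' t \<ge> 0" if "t \<in> S" for t
      proof (rule mono_on_imp_deriv_nonneg[OF m])
        show "((\<lambda>t. - v t) has_real_derivative - v' t) (at t)"
          using v[OF that] by (auto intro!: derivative_eq_intros)
      qed (use that S(2) in \<open>simp add: interior_open\<close>)
      have "norm (g b - g a) \<le> - (K * v b) - - (K * v a)"
      proof (rule differentiable_bound_general[OF ab(1) cg])
        show "continuous_on {a..b} (\<lambda>t. - (K * v t))"
          by (intro continuous_intros continuous_on_subset[OF cont sub])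
        show "(g has_vector_derivative g' t) (at t)" if "a < t" "t < b" for t
          using g mem that by auto
        show "((\<lambda>t. - (K * v t)) has_vector_derivative - (K * v' t)) (at t)" if "a < t" "t < b" for t
          using v[OF mem[OF that]]
          by (auto simp flip: has_real_derivative_iff_has_vector_derivative intro!: derivative_eq_intros)
        show "norm (g' t) \<le> - (K * v' t)" if "a < t" "t < b" for t
          using bound[OF mem[OF that]] nn[OF mem[OF that]] by simp
      qed
      moreover have "\<bar>v b - v a\<bar> = v a - v b" using mono_onD[OF m ab(2,3)] ab(1) by simp
      ultimately show ?thesis by (simp add: right_diff_distrib)
    qed
  qed
  show ?thesis
    using *[OF _ xy] *[OF _ xy(2) xy(1)] by (cases x y rule: linorder_cases) (auto simp: norm_minus_commute abs_minus_commute)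
qed

text \<open>Here \<open>f\<close> is the first integral in the coordinates \<open>(Re f, y)\<close>. Going from \<open>(u0, s0)\<close> to
  \<open>(u1, s1)\<close> through \<open>(u1, s0)\<close>, the increment of \<open>g - f\<close> is at most
  \<open>(1 + 3 + 3) / 14\<close> times the increment of \<open>f\<close>.\<close>

lemma inj_on_straightened:
  fixes f g :: "real \<Rightarrow> real \<Rightarrow> complex"
  assumes I: "convex I" and J: "is_interval J" "open J"
    and re: "\<And>u s. u \<in> I \<Longrightarrow> s \<in> J \<Longrightarrow> Re (f u s) = u"
    and inj: "\<And>u s s'. u \<in> I \<Longrightarrow> s \<in> J \<Longrightarrow> s' \<in> J \<Longrightarrow> f u s = f u s' \<Longrightarrow> s = s'"
    and fu: "\<And>u s. u \<in> I \<Longrightarrow> s \<in> J \<Longrightarrow> ((\<lambda>t. f t s) has_vector_derivative fu u s) (at u)"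
    and fs: "\<And>u s. u \<in> I \<Longrightarrow> s \<in> J \<Longrightarrow> ((\<lambda>t. f u t) has_vector_derivative fs u s) (at s)"
    and gu: "\<And>u s. u \<in> I \<Longrightarrow> s \<in> J \<Longrightarrow> ((\<lambda>t. g t s) has_vector_derivative m u s * fu u s) (at u)"
    and gs: "\<And>u s. u \<in> I \<Longrightarrow> s \<in> J \<Longrightarrow> ((\<lambda>t. g u t) has_vector_derivative m u s * fs u s) (at s)"
    and fu_le: "\<And>u s. u \<in> I \<Longrightarrow> s \<in> J \<Longrightarrow> norm (fu u s) \<le> 3"
    and m: "\<And>u s. u \<in> I \<Longrightarrow> s \<in> J \<Longrightarrow> norm (m u s - 1) \<le> 1/14"
    and pts: "u0 \<in> I" "s0 \<in> J" "u1 \<in> I" "s1 \<in> J" and eq: "g u0 s0 = g u1 s1"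
  shows "u0 = u1 \<and> s0 = s1"
proof -
  define d where "d u s = g u s - f u s" for u s
  have du: "((\<lambda>t. d t s) has_vector_derivative (m u s - 1) * fu u s) (at u)" if "u \<in> I" "s \<in> J" for u s
    unfolding d_def using has_vector_derivative_diff[OF gu[OF that] fu[OF that]] by (simp add: algebra_simps)
  have ds: "((\<lambda>t. d u t) has_vector_derivative (m u s - 1) * fs u s) (at s)" if "u \<in> I" "s \<in> J" for u s
    unfolding d_def using has_vector_derivative_diff[OF gs[OF that] fs[OF that]] by (simp add: algebra_simps)
  have f_hor: "norm (f u1 s0 - f u0 s0) \<le> 3 * \<bar>u1 - u0\<bar>"
    by (rule vector_derivative_bound[OF I fu]) (use pts fu_le in auto)
  have "norm ((m u s0 - 1) * fu u s0) \<le> 3/14" if "u \<in> I" for u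
    using mult_mono[OF m[OF that pts(2)] fu_le[OF that pts(2)]] by (simp add: norm_mult)
  then have d_hor: "norm (d u1 s0 - d u0 s0) \<le> 3/14 * \<bar>u1 - u0\<bar>"
    by (intro vector_derivative_bound[OF I du]) (use pts in auto)
  have dIm: "((\<lambda>t. Im (f u1 t)) has_real_derivative Im (fs u1 s)) (at s)" if "s \<in> J" for s
    using bounded_linear.has_vector_derivative[OF bounded_linear_Im fs[OF pts(3) that]]
    by (simp add: has_real_derivative_iff_has_vector_derivative)
  \<comment> \<open>The real part of \<open>f\<close> is constant on vertical lines, so the vertical
    derivative is purely imaginary and its norm is the speed of \<open>Im f\<close>.\<close>
  have fsRe: "Re (fs u1 s) = 0" if s: "s \<in> J" for s
  proof -
    have "((\<lambda>t. Re (f u1 t)) has_vector_derivative Re (fs u1 s)) (at s)"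
      using bounded_linear.has_vector_derivative[OF bounded_linear_Re fs[OF pts(3) s]] .
    moreover have "((\<lambda>t. Re (f u1 t)) has_vector_derivative 0) (at s)"
      by (rule has_vector_derivative_transform_within_open[of "\<lambda>_. u1", OF _ J(2) s])
        (use re pts in auto)
    ultimately show ?thesis by (rule vector_derivative_unique_at)
  qed
  have normfs: "norm (fs u1 s) = \<bar>Im (fs u1 s)\<bar>" if "s \<in> J" for s
    using fsRe[OF that] by (simp add: cmod_def)
  have d_ver: "norm (d u1 s1 - d u1 s0) \<le> 1/14 * \<bar>Im (f u1 s1) - Im (f u1 s0)\<bar>"
  proof (rule monotone_vector_derivative_bound[OF J _ dIm ds])
    \<comment> \<open>Two points of a vertical line share the real part of \<open>f\<close>; equal
      imaginary parts would contradict injectivity of \<open>f\<close> there.\<close>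
    show "inj_on (\<lambda>s. Im (f u1 s)) J"
      using inj[OF pts(3)] re[OF pts(3)] by (auto intro!: inj_onI simp: complex_eq_iff)
    show "norm ((m u1 t - 1) * fs u1 t) \<le> 1/14 * \<bar>Im (fs u1 t)\<bar>" if "t \<in> J" for t
      using mult_right_mono[OF m[OF pts(3) that], of "norm (fs u1 t)"] normfs[OF that] by (simp add: norm_mult)
  qed (use pts in auto)
  have "\<bar>Im (f u1 s1) - Im (f u1 s0)\<bar> \<le> norm (f u1 s1 - f u1 s0)"
    using abs_Im_le_cmod[of "f u1 s1 - f u1 s0"] by simp
  also have "\<dots> \<le> norm (f u1 s1 - f u0 s0) + norm (f u1 s0 - f u0 s0)"
    using norm_triangle_ineq4[of "f u1 s1 - f u0 s0" "f u1 s0 - f u0 s0"] by simp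
  finally have ver: "\<bar>Im (f u1 s1) - Im (f u1 s0)\<bar> \<le> norm (f u1 s1 - f u0 s0) + 3 * \<bar>u1 - u0\<bar>"
    using f_hor by simp
  have hor: "\<bar>u1 - u0\<bar> \<le> norm (f u1 s1 - f u0 s0)"
    using abs_Re_le_cmod[of "f u1 s1 - f u0 s0"] re pts by simp
  have "norm (d u1 s1 - d u0 s0) \<le> norm (d u1 s1 - d u1 s0) + norm (d u1 s0 - d u0 s0)"
    using norm_triangle_ineq[of "d u1 s1 - d u1 s0" "d u1 s0 - d u0 s0"] by simp
  \<comment> \<open>As \<open>g\<close> takes the same value at both ends, the error
    \<open>d\<close> carries the whole increment of \<open>f\<close>. The bounds give it at most
    half of that increment, which must therefore be zero.\<close>
  moreover have "norm (d u1 s1 - d u0 s0) = norm (f u1 s1 - f u0 s0)"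
    using eq by (simp add: d_def norm_minus_commute)
  moreover note d_ver d_hor
  ultimately have "norm (f u1 s1 - f u0 s0)
      \<le> 1/14 * (norm (f u1 s1 - f u0 s0) + 3 * norm (f u1 s1 - f u0 s0))
        + 3/14 * norm (f u1 s1 - f u0 s0)"
    using ver hor by argo
  then have "f u1 s1 = f u0 s0" by simp
  moreover from this have "u1 = u0" using hor by simp
  ultimately show ?thesis using inj[OF pts(3,2,4)] by simp
qed

section \<open>Straightening coordinates for a pair of proportional differentials\<close>

definition eval_form :: "complex \<times> complex \<Rightarrow> real \<times> real \<Rightarrow> complex" where
  "eval_form v h = fst h *\<^sub>R fst v + snd h *\<^sub>R snd v"

lemma has_derivative_imp_partials:
  assumes "(F has_derivative F') (at (u, s))"
  shows "((\<lambda>t. F (t, s)) has_vector_derivative F' (1, 0)) (at u)"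
    and "((\<lambda>t. F (u, t)) has_vector_derivative F' (0, 1)) (at s)"
proof -
  interpret F': bounded_linear F' using assms by (rule has_derivative_bounded_linear)
  have "((\<lambda>t. (t, s)) has_derivative (\<lambda>h. (h, 0))) (at u)"
    by (auto intro!: derivative_eq_intros)
  from has_derivative_compose[OF this assms]
  have 1: "((\<lambda>t. F (t, s)) has_derivative (\<lambda>h. F' (h, 0))) (at u)" .
  have "((\<lambda>t. (u, t)) has_derivative (\<lambda>h. (0, h))) (at s)"
    by (auto intro!: derivative_eq_intros)
  from has_derivative_compose[OF this assms]
  have 2: "((\<lambda>t. F (u, t)) has_derivative (\<lambda>h. F' (0, h))) (at s)" .
  have "F' (h, 0) = h *\<^sub>R F' (1, 0)" "F' (0, h) = h *\<^sub>R F' (0, 1)" for h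
    using F'.scaleR[of h "(1, 0)"] F'.scaleR[of h "(0, 1)"] by simp_all
  then have "(\<lambda>h. F' (h, 0)) = (\<lambda>h. h *\<^sub>R F' (1, 0))" "(\<lambda>h. F' (0, h)) = (\<lambda>h. h *\<^sub>R F' (0, 1))"
    by blast+
  with 1 2 show "((\<lambda>t. F (t, s)) has_vector_derivative F' (1, 0)) (at u)"
    and "((\<lambda>t. F (u, t)) has_vector_derivative F' (0, 1)) (at s)"
    by (simp_all only: has_vector_derivative_def)
qed

text \<open>Since \<open>c1 p = 1\<close>, the x-derivative of \<open>Re \<zeta>\<close> is positive
  near \<open>p\<close>, so \<Phi> is a chart even where d\<zeta> has real rank 1. In this chart
  \<zeta> and \<open>Z\<close> satisfy the hypotheses of \<open>inj_on_straightened\<close> with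
  multiplier \<open>a / c1\<close>, whose value at \<open>p\<close> is 1.\<close>

lemma proportional_forms_inj_normalized:
  fixes \<zeta> Z :: "real \<times> real \<Rightarrow> complex"
  assumes U: "open U" "p \<in> U" and inj: "inj_on \<zeta> U"
    and d\<zeta>: "\<And>q. q \<in> U \<Longrightarrow> (\<zeta> has_derivative eval_form (c1 q, c2 q)) (at q)"
    and dZ: "\<And>q. q \<in> U \<Longrightarrow> (Z has_derivative eval_form (a q, b q)) (at q)"
    and cont: "isCont c1 p" "isCont a p" and norm1: "c1 p = 1" "a p = 1"
    and par: "\<And>q. q \<in> U \<Longrightarrow> c1 q * b q = c2 q * a q"
  shows "\<exists>V. open V \<and> p \<in> V \<and> inj_on Z V"
proof -
  define m where "m q = a q / c1 q" for q
  have "isCont m p" unfolding m_def using cont norm1 by (intro continuous_intros) auto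
  then have "\<forall>\<^sub>F q in nhds p. dist (m q) (m p) < 1/14"
    using tendstoD[of m "m p" "nhds p" "1/14"] by (simp add: isCont_def tendsto_nhds_iff)
  \<comment> \<open>Distance 1/2 gives \<open>Re (c1 q) \<ge> 1/2\<close> and
    \<open>norm (c1 q) \<le> 3/2\<close>; their quotient is the bound 3 on the horizontal
    speed.\<close>
  moreover have "\<forall>\<^sub>F q in nhds p. dist (c1 q) (c1 p) < 1/2"
    using cont tendstoD[of c1 "c1 p" "nhds p" "1/2"] by (simp add: isCont_def tendsto_nhds_iff)
  moreover have "\<forall>\<^sub>F q in nhds p. q \<in> U" using U by (rule eventually_nhds_in_open)
  ultimately have "\<forall>\<^sub>F q in nhds p. dist (m q) (m p) < 1/14 \<and> dist (c1 q) (c1 p) < 1/2 \<and> q \<in> U"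
    by eventually_elim auto
  then obtain \<delta> where "\<delta> > 0" and \<delta>: "\<And>q. dist q p < \<delta> \<Longrightarrow>
      dist (m q) (m p) < 1/14 \<and> dist (c1 q) (c1 p) < 1/2 \<and> q \<in> U"
    unfolding eventually_nhds_metric by blast
  define S where "S = ball p \<delta>"
  have S: "open S" "p \<in> S" "S \<subseteq> U" using \<delta> \<open>\<delta> > 0\<close> by (auto simp: S_def dist_commute)
  have m1: "norm (m q - 1) \<le> 1/14" and c1: "norm (c1 q - 1) \<le> 1/2" if "q \<in> S" for q
    using \<delta>[of q] that norm1 by (auto simp: S_def dist_commute dist_norm norm_minus_commute m_def)
  have Re_c1: "Re (c1 q) \<ge> 1/2" and norm_c1: "norm (c1 q) \<le> 3/2" if "q \<in> S" for q
    using c1[OF that] abs_Re_le_cmod[of "c1 q - 1"] norm_triangle_ineq[of "c1 q - 1" 1] by auto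
  define \<Phi> where "\<Phi> q = (Re (\<zeta> q), snd q)" for q
  have d\<Phi>: "(\<Phi> has_derivative (\<lambda>h. (Re (eval_form (c1 q, c2 q) h), snd h))) (at q)" if "q \<in> S" for q
    unfolding \<Phi>_def using d\<zeta>[of q] that S
    by (auto intro!: derivative_eq_intros bounded_linear.has_derivative[OF bounded_linear_Re])
  have cont\<Phi>: "continuous_on S \<Phi>"
    using d\<Phi> by (meson continuous_at_imp_continuous_on has_derivative_continuous)
  have inj\<Phi>: "inj_on \<Phi> S"
  proof (rule inj_onI)
    fix q q' assume q: "q \<in> S" "q' \<in> S" "\<Phi> q = \<Phi> q'"
    define s where "s = snd q"
    have eqs: "q = (fst q, s)" "q' = (fst q', s)" using q(3) by (auto simp: \<Phi>_def s_def prod_eq_iff)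
    \<comment> \<open>Along a horizontal chord, \<zeta> differs from the identity by a map with
      Lipschitz constant 1/2. If \<open>Re \<zeta>\<close> agrees at both ends, the distance of the
      ends is at most half of itself.\<close>
    have "norm ((\<zeta> (fst q, s) - fst q) - (\<zeta> (fst q', s) - fst q')) \<le> 1/2 * \<bar>fst q - fst q'\<bar>"
    proof (rule vector_derivative_bound[of "(\<lambda>t. (t, s)) -` S" "\<lambda>t. \<zeta> (t, s) - of_real t"
            "\<lambda>t. c1 (t, s) - 1"])
      show "convex ((\<lambda>t. (t, s)) -` S)"
      proof (rule convexI)
        fix x y u v :: real
        assume *: "x \<in> (\<lambda>t. (t, s)) -` S" "y \<in> (\<lambda>t. (t, s)) -` S" "0 \<le> u" "0 \<le> v" "u + v = 1"
        then have "u *\<^sub>R (x, s) + v *\<^sub>R (y, s) \<in> S"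
          using convexD[of S "(x, s)" "(y, s)" u v] by (simp add: S_def)
        moreover have "u * s + v * s = s" using *(5) by (simp flip: distrib_right)
        ultimately show "u *\<^sub>R x + v *\<^sub>R y \<in> (\<lambda>t. (t, s)) -` S" by simp
      qed
    next
      fix t assume t: "t \<in> (\<lambda>t. (t, s)) -` S"
      then have "((\<lambda>t. \<zeta> (t, s)) has_vector_derivative c1 (t, s)) (at t)"
        using has_derivative_imp_partials(1)[OF d\<zeta>[of "(t, s)"]] S by (auto simp: eval_form_def)
      then show "((\<lambda>t. \<zeta> (t, s) - of_real t) has_vector_derivative c1 (t, s) - 1) (at t)"
        by (auto intro!: derivative_eq_intros)
      show "norm (c1 (t, s) - 1) \<le> 1/2" using c1 t by simp
    qed (use q eqs in auto)
    moreover have "\<bar>fst q - fst q'\<bar> \<le> norm ((\<zeta> q - fst q) - (\<zeta> q' - fst q'))"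
      using abs_Re_le_cmod[of "(\<zeta> q - fst q) - (\<zeta> q' - fst q')"] q(3) by (auto simp: \<Phi>_def)
    ultimately have "\<bar>fst q - fst q'\<bar> \<le> 1/2 * \<bar>fst q - fst q'\<bar>" using eqs by simp
    then show "q = q'" using eqs by (simp add: prod_eq_iff)
  qed
  have "open (\<Phi> ` S)" by (rule invariance_of_domain[OF cont\<Phi> S(1) inj\<Phi>])
  moreover have "\<Phi> p \<in> \<Phi> ` S" using S by simp
  ultimately obtain I' J' where IJ': "open I'" "open J'" "\<Phi> p \<in> I' \<times> J'" "I' \<times> J' \<subseteq> \<Phi> ` S"
    by (rule open_prod_elim)
  obtain e where e: "e > 0" "ball (fst (\<Phi> p)) e \<subseteq> I'" "ball (snd (\<Phi> p)) e \<subseteq> J'"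
  proof -
    have "fst (\<Phi> p) \<in> I'" "snd (\<Phi> p) \<in> J'" using IJ'(3) by (simp_all add: mem_Times_iff)
    then obtain e1 e2 where "e1 > 0" "ball (fst (\<Phi> p)) e1 \<subseteq> I'" "e2 > 0" "ball (snd (\<Phi> p)) e2 \<subseteq> J'"
      using IJ'(1,2) unfolding open_contains_ball by blast
    then show ?thesis by (intro that[of "min e1 e2"]) (simp_all add: ball_subset_ball_iff subset_iff)
  qed
  define I J where "I = ball (fst (\<Phi> p)) e" and "J = ball (snd (\<Phi> p)) e"
  have IJ: "I \<times> J \<subseteq> \<Phi> ` S" 
    using Sigma_mono[OF e(2), of "\<lambda>_. J" "\<lambda>_. J'"] e(3) IJ'(4) unfolding I_def J_def by blast
  define \<Psi> where "\<Psi> = inv_into S \<Phi>"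
  have \<Psi>: "\<Psi> w \<in> S" "\<Phi> (\<Psi> w) = w" if "w \<in> I \<times> J" for w
    using subsetD[OF IJ that] unfolding \<Psi>_def by (simp_all only: inv_into_into f_inv_into_f)
  have \<Psi>\<Phi>: "\<Psi> (\<Phi> q) = q" if "q \<in> S" for q using inj\<Phi> that by (simp add: \<Psi>_def)
  \<comment> \<open>The derivative of \<Phi> is triangular with diagonal \<open>Re c1\<close> and 1;
    this is its explicit inverse.\<close>
  have d\<Psi>: "(\<Psi> has_derivative (\<lambda>h. ((fst h - snd h * Re (c2 (\<Psi> w))) / Re (c1 (\<Psi> w)), snd h))) (at w)"
    if w: "w \<in> I \<times> J" for w
  proof (rule has_derivative_inverse_strong_x[OF S(1) \<Psi>(1)[OF w] cont\<Phi> \<Psi>\<Phi> d\<Phi>[OF \<Psi>(1)[OF w]] _ \<Psi>(2)[OF w]])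
    show "(\<lambda>h. (Re (eval_form (c1 (\<Psi> w), c2 (\<Psi> w)) h), snd h)) \<circ>
        (\<lambda>h. ((fst h - snd h * Re (c2 (\<Psi> w))) / Re (c1 (\<Psi> w)), snd h)) = id"
      using Re_c1[OF \<Psi>(1)[OF w]] by (auto simp: fun_eq_iff eval_form_def)
  qed
  have comp: "((\<lambda>w. F (\<Psi> w)) has_derivative (\<lambda>h. F'
        ((fst h - snd h * Re (c2 (\<Psi> w))) / Re (c1 (\<Psi> w)), snd h))) (at w)"
    if "w \<in> I \<times> J" "(F has_derivative F') (at (\<Psi> w))" for F F' w
    using has_derivative_compose[OF d\<Psi>[OF that(1)] that(2)] .
  define f g where "f u s = \<zeta> (\<Psi> (u, s))" and "g u s = Z (\<Psi> (u, s))" for u s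
  define M where "M u s = m (\<Psi> (u, s))" for u s
  \<comment> \<open>\<open>fu\<close> and \<open>fs\<close> are d\<zeta> applied to the columns of
    the derivative of \<Psi>, namely \<open>(1 / Re c1, 0)\<close> and
    \<open>(- Re c2 / Re c1, 1)\<close>.\<close>
  define fu where "fu u s = c1 (\<Psi> (u, s)) /\<^sub>R Re (c1 (\<Psi> (u, s)))" for u s
  define fs where "fs u s = c2 (\<Psi> (u, s)) - (Re (c2 (\<Psi> (u, s))) / Re (c1 (\<Psi> (u, s)))) *\<^sub>R c1 (\<Psi> (u, s))" for u s
  have straight: "u0 = u1 \<and> s0 = s1"
    if "u0 \<in> I" "s0 \<in> J" "u1 \<in> I" "s1 \<in> J" "g u0 s0 = g u1 s1" for u0 s0 u1 s1
  proof (rule inj_on_straightened[of I J f fu fs g M])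
    fix u s assume us: "u \<in> I" "s \<in> J"
    define q where "q = \<Psi> (u, s)"
    have q: "q \<in> S" "q \<in> U" "\<Phi> q = (u, s)" using \<Psi>[of "(u, s)"] us S by (auto simp: q_def)
    have c1nz: "c1 q \<noteq> 0" using Re_c1[OF q(1)] by auto
    show "Re (f u s) = u" using q by (simp add: f_def \<Phi>_def q_def)
    show "s = s'" if "s' \<in> J" "f u s = f u s'" for s'
    proof -
      have s': "(u, s') \<in> I \<times> J" using us that by simp
      have "\<zeta> q = \<zeta> (\<Psi> (u, s'))" using that(2) unfolding f_def q_def .
      then have "q = \<Psi> (u, s')"
        using inj_onD[OF inj _ q(2)] subsetD[OF S(3) \<Psi>(1)[OF s']] by metis
      then have "(u, s) = (u, s')" using q(3) \<Psi>(2)[OF s'] by metis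
      then show ?thesis by simp
    qed
    have us': "(u, s) \<in> I \<times> J" using us by simp
    have d: "(\<zeta> has_derivative eval_form (c1 q, c2 q)) (at (\<Psi> (u, s)))"
      "(Z has_derivative eval_form (a q, b q)) (at (\<Psi> (u, s)))"
      using d\<zeta>[OF q(2)] dZ[OF q(2)] by (simp_all add: q_def)
    note D1 = has_derivative_imp_partials[OF comp[OF us' d(1)], folded q_def]
    note D2 = has_derivative_imp_partials[OF comp[OF us' d(2)], folded q_def]
    show "((\<lambda>t. f t s) has_vector_derivative fu u s) (at u)"
      unfolding f_def using D1(1)
      by (rule has_vector_derivative_eq_rhs) (simp add: fu_def eval_form_def divide_inverse flip: q_def)
    show "(f u has_vector_derivative fs u s) (at s)"
      unfolding f_def[abs_def] using D1(2)
      by (rule has_vector_derivative_eq_rhs) (simp add: fs_def eval_form_def flip: q_def)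
    \<comment> \<open>With \<open>aq\<close> below this says dZ = m d\<zeta>: the same multiplier
      appears in both coordinate directions.\<close>
    have bq: "b q = m q * c2 q" using par[OF q(2)] c1nz by (simp add: m_def field_simps)
    have aq: "a q = m q * c1 q" using c1nz by (simp add: m_def)
    have gu: "a q /\<^sub>R Re (c1 q) = M u s * fu u s"
      by (simp add: aq M_def fu_def flip: q_def)
    have gs: "b q - (Re (c2 q) / Re (c1 q)) *\<^sub>R a q = M u s * fs u s"
      by (simp add: aq bq M_def fs_def algebra_simps flip: q_def)
    show "((\<lambda>t. g t s) has_vector_derivative M u s * fu u s) (at u)"
      unfolding g_def gu[symmetric] using D2(1)
      by (rule has_vector_derivative_eq_rhs) (simp add: eval_form_def divide_inverse)
    show "(g u has_vector_derivative M u s * fs u s) (at s)"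
      unfolding g_def[abs_def] gs[symmetric] using D2(2)
      by (rule has_vector_derivative_eq_rhs) (simp add: eval_form_def)
    show "norm (fu u s) \<le> 3"
      using Re_c1[OF q(1)] norm_c1[OF q(1)] by (simp add: fu_def field_simps flip: q_def)
    show "norm (M u s - 1) \<le> 1/14" using m1[OF q(1)] by (simp add: M_def q_def)
  qed (use that in \<open>auto simp: I_def J_def is_interval_ball_real\<close>)
  define V where "V = S \<inter> \<Phi> -` (I \<times> J)"
  have "inj_on Z V"
  proof (rule inj_onI)
    fix q q' assume q: "q \<in> V" "q' \<in> V" "Z q = Z q'"
    then have "fst (\<Phi> q) = fst (\<Phi> q') \<and> snd (\<Phi> q) = snd (\<Phi> q')"
      by (intro straight) (auto simp: V_def g_def \<Psi>\<Phi> mem_Times_iff)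
    then have "\<Phi> q = \<Phi> q'" by (simp add: prod_eq_iff)
    then show "q = q'" by (rule inj_onD[OF inj\<Phi>]) (use q in \<open>auto simp: V_def\<close>)
  qed
  moreover have "open V" unfolding V_def
    by (rule continuous_open_preimage[OF cont\<Phi> S(1)]) (auto simp: I_def J_def open_Times)
  moreover have "p \<in> V" using S e by (auto simp: V_def I_def J_def mem_Times_iff)
  ultimately show ?thesis by blast
qed

text \<open>Proportionality passes the non-vanishing of \<open>c1 p\<close> on to
  \<open>a p\<close>: otherwise \<open>b p\<close> would vanish too. Dividing each function by its
  constant changes neither injectivity nor proportionality and reaches the normalised case.\<close>

lemma proportional_forms_inj_fst:
  fixes \<zeta> Z :: "real \<times> real \<Rightarrow> complex"
  assumes U: "open U" "p \<in> U" and inj: "inj_on \<zeta> U"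
    and d\<zeta>: "\<And>q. q \<in> U \<Longrightarrow> (\<zeta> has_derivative eval_form (c1 q, c2 q)) (at q)"
    and dZ: "\<And>q. q \<in> U \<Longrightarrow> (Z has_derivative eval_form (a q, b q)) (at q)"
    and cont: "isCont c1 p" "isCont a p" and nz: "c1 p \<noteq> 0" "(a p, b p) \<noteq> (0, 0)"
    and par: "\<And>q. q \<in> U \<Longrightarrow> c1 q * b q = c2 q * a q"
  shows "\<exists>V. open V \<and> p \<in> V \<and> inj_on Z V"
proof -
  have a: "a p \<noteq> 0" using par[OF U(2)] nz by auto
  have scale: "((\<lambda>q. F q / k) has_derivative eval_form (v / k, w / k)) (at q)"
    if "(F has_derivative eval_form (v, w)) (at q)" for F k v w q
    by (rule has_derivative_eq_rhs[OF bounded_linear.has_derivative[OF bounded_linear_divide that]])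
      (auto simp: eval_form_def fun_eq_iff add_divide_distrib scaleR_conv_of_real)
  have "\<exists>V. open V \<and> p \<in> V \<and> inj_on (\<lambda>q. Z q / a p) V"
  proof (rule proportional_forms_inj_normalized[OF U, of "\<lambda>q. \<zeta> q / c1 p"])
    show "inj_on (\<lambda>q. \<zeta> q / c1 p) U" using inj nz by (auto simp: inj_on_def)
    show "isCont (\<lambda>q. c1 q / c1 p) p" "isCont (\<lambda>q. a q / a p) p"
      using cont nz a by (auto intro!: continuous_intros)
    show "c1 q / c1 p * (b q / a p) = c2 q / c1 p * (a q / a p)" if "q \<in> U" for q
      using par[OF that] by simp
  qed (use scale d\<zeta> dZ nz a in auto)
  then show ?thesis using a by (auto simp: inj_on_def)
qed

text \<open>If \<open>c1 p\<close> vanishes then \<open>c2 p\<close> does not, and exchanging the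
  two coordinates of the plane reduces to the previous lemma with \<open>c1\<close>,
  \<open>c2\<close> and \<open>a\<close>, \<open>b\<close> interchanged.\<close>

lemma proportional_forms_inj:
  fixes \<zeta> Z :: "real \<times> real \<Rightarrow> complex"
  assumes U: "open U" "p \<in> U" and inj: "inj_on \<zeta> U"
    and d\<zeta>: "\<And>q. q \<in> U \<Longrightarrow> (\<zeta> has_derivative eval_form (c1 q, c2 q)) (at q)"
    and dZ: "\<And>q. q \<in> U \<Longrightarrow> (Z has_derivative eval_form (a q, b q)) (at q)"
    and cont: "isCont c1 p" "isCont c2 p" "isCont a p" "isCont b p"
    and nz: "(c1 p, c2 p) \<noteq> (0, 0)" "(a p, b p) \<noteq> (0, 0)"
    and par: "\<And>q. q \<in> U \<Longrightarrow> c1 q * b q = c2 q * a q"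
  shows "\<exists>V. open V \<and> p \<in> V \<and> inj_on Z V"
proof (cases "c1 p = 0")
  case False
  show ?thesis by (rule proportional_forms_inj_fst[OF U inj d\<zeta> dZ cont(1,3) False nz(2) par])
next
  case True
  have cont_swap: "isCont prod.swap q" for q :: "real \<times> real"
    unfolding prod.swap_def by (intro continuous_intros)
  have isCont_swap: "isCont (\<lambda>q. h (prod.swap q)) (prod.swap p)" if "isCont h p" for h :: "real \<times> real \<Rightarrow> complex"
    using isCont_o2[OF cont_swap[of "prod.swap p"], of h] that by simp
  have d_swap: "((\<lambda>q. F (prod.swap q)) has_derivative eval_form (w, v)) (at q)"
    if "(F has_derivative eval_form (v, w)) (at (prod.swap q))" for F q v w
  proof -
    have "(prod.swap has_derivative prod.swap) (at q)"
      unfolding prod.swap_def by (auto intro!: derivative_eq_intros)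
    from has_derivative_compose[OF this that] show ?thesis
      by (rule has_derivative_eq_rhs) (auto simp: eval_form_def fun_eq_iff)
  qed
  have "\<exists>V. open V \<and> prod.swap p \<in> V \<and> inj_on (\<lambda>q. Z (prod.swap q)) V"
  proof (rule proportional_forms_inj_fst[of "prod.swap -` U" _ "\<lambda>q. \<zeta> (prod.swap q)"
        "\<lambda>q. c2 (prod.swap q)" "\<lambda>q. c1 (prod.swap q)" _ "\<lambda>q. b (prod.swap q)" "\<lambda>q. a (prod.swap q)"])
    show "open (prod.swap -` U)"
      using U cont_swap by (intro open_vimage continuous_at_imp_continuous_on) auto
    show "inj_on (\<lambda>q. \<zeta> (prod.swap q)) (prod.swap -` U)"
      using comp_inj_on[of prod.swap "prod.swap -` U" \<zeta>] inj_on_subset[OF inj, of "prod.swap ` (prod.swap -` U)"]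
      by (auto simp: o_def)
    show "isCont (\<lambda>q. c2 (prod.swap q)) (prod.swap p)" "isCont (\<lambda>q. b (prod.swap q)) (prod.swap p)"
      using isCont_swap cont by blast+
  qed (use U d_swap d\<zeta> dZ nz True par in auto)
  then obtain V where V: "open V" "prod.swap p \<in> V" "inj_on (\<lambda>q. Z (prod.swap q)) V" by blast
  have "open (prod.swap -` V)"
    using V cont_swap by (intro open_vimage continuous_at_imp_continuous_on) auto
  moreover have "inj_on Z (prod.swap -` V)"
    using inj_on_imageI[of Z prod.swap V] V(3) by (auto simp: o_def elim!: inj_on_subset)
  ultimately show ?thesis using V(2) by auto
qed

section \<open>Primitives of closed forms\<close>

text \<open>The covector as a bounded linear map, the type in which \<open>leibniz_rule\<close>
  expects a continuous family of derivatives.\<close>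

definition form_blinfun :: "complex \<Rightarrow> complex \<Rightarrow> (real \<times> real) \<Rightarrow>\<^sub>L complex" where
  "form_blinfun v w = (blinfun_scaleR_left v o\<^sub>L fst_blinfun) + (blinfun_scaleR_left w o\<^sub>L snd_blinfun)"

lemma blinfun_apply_form_blinfun: "blinfun_apply (form_blinfun v w) = eval_form (v, w)"
  by (auto simp: form_blinfun_def eval_form_def blinfun.add_left fun_eq_iff)

lemma has_derivative_differential:
  assumes "f differentiable at q"
  shows "(f has_derivative eval_form (differential f q)) (at q)"
proof -
  let ?f' = "frechet_derivative f (at q)"
  have f': "(f has_derivative ?f') (at q)"
    using assms by (simp add: frechet_derivative_works)
  then interpret f': bounded_linear ?f' by (rule has_derivative_bounded_linear)
  have "?f' (x, y) = eval_form (differential f q) (x, y)" for x y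
  proof -
    have "?f' (x, y) = ?f' (x *\<^sub>R (1, 0) + y *\<^sub>R (0, 1))" by simp
    also have "\<dots> = x *\<^sub>R ?f' (1, 0) + y *\<^sub>R ?f' (0, 1)" by (simp only: f'.add f'.scaleR)
    finally show ?thesis by (simp add: eval_form_def differential_def partial_x_def partial_y_def)
  qed
  then have "?f' = eval_form (differential f q)" by (simp add: fun_eq_iff)
  with f' show ?thesis by simp
qed

lemma primitive_eq_integral:
  "primitive \<Omega> q = integral {0..1} (\<lambda>t. eval_form (\<Omega> (t *\<^sub>R q)) q)"
  unfolding primitive_def line_integral_def
proof (rule integral_cong)
  fix t :: real assume "t \<in> {0..1}"
  then have "vector_derivative (linepath (0, 0) q) (at t within {0..1}) = q"
    by (simp add: vector_derivative_linepath_within flip: zero_prod_def)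
  then show "(let v = vector_derivative (linepath (0, 0) q) (at t within {0..1})
        in fst (\<Omega> (linepath (0, 0) q t)) * of_real (fst v) +
           snd (\<Omega> (linepath (0, 0) q t)) * of_real (snd v)) = eval_form (\<Omega> (t *\<^sub>R q)) q"
    by (simp add: eval_form_def linepath_def scaleR_conv_of_real mult.commute flip: zero_prod_def)
qed

text \<open>The Poincare lemma on a star-shaped domain. Differentiating under the integral in
  direction \<open>h\<close> and using closedness turns the integrand into the t-derivative of t
  times the form at \<open>t *\<^sub>R q\<close> applied to \<open>h\<close>, and the fundamental
  theorem leaves its value at t = 1.\<close>

lemma closed_form_primitive_has_derivative:
  fixes a b :: "real \<times> real \<Rightarrow> complex"
  assumes diff: "\<And>q. a differentiable at q" "\<And>q. b differentiable at q"
    and cont: "continuous_on UNIV (partial_x a)" "continuous_on UNIV (partial_y a)"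
      "continuous_on UNIV (partial_x b)" "continuous_on UNIV (partial_y b)"
    and closed: "closed_form (\<lambda>q. (a q, b q))"
  shows "(primitive (\<lambda>q. (a q, b q)) has_derivative eval_form (a q, b q)) (at q)"
proof -
  have clo: "partial_x b p = partial_y a p" for p using closed unfolding closed_form_def fst_conv snd_conv by blast
  have conta: "continuous_on UNIV a" and contb: "continuous_on UNIV b"
    using diff by (meson differentiable_imp_continuous_on differentiable_on_def differentiable_at_withinI)+
  have da: "(a has_derivative eval_form (partial_x a p, partial_y a p)) (at p)" for p
    using has_derivative_differential[OF diff(1)] by (simp add: differential_def)
  have db: "(b has_derivative eval_form (partial_y a p, partial_y b p)) (at p)" for p
    using has_derivative_differential[OF diff(2)] clo by (simp add: differential_def)
  have comp: "((\<lambda>x. F (t *\<^sub>R x)) has_derivative (\<lambda>h. F' (t *\<^sub>R h))) (at p)"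
    if "(F has_derivative F') (at (t *\<^sub>R p))" for F F' t p
    by (rule has_derivative_compose[where f = "\<lambda>x. t *\<^sub>R x"])
      (use that in \<open>auto intro!: derivative_eq_intros\<close>)
  have comp_t: "((\<lambda>t. F (t *\<^sub>R p)) has_vector_derivative F' p) (at t)"
    if "(F has_derivative F') (at (t *\<^sub>R p))" for F F' t p
  proof -
    interpret F': bounded_linear F' using that by (rule has_derivative_bounded_linear)
    have "((\<lambda>t. t *\<^sub>R p) has_derivative (\<lambda>h. h *\<^sub>R p)) (at t)"
      by (auto intro!: derivative_eq_intros)
    from has_derivative_compose[OF this that] show ?thesis
      by (simp add: has_vector_derivative_def F'.scaleR)
  qed
  \<comment> \<open>\<open>u\<close> and \<open>v\<close> have two readings. They are the partial
    derivatives in \<open>p\<close> of the integrand and, since the x-derivative of \<open>b\<close>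
    is the y-derivative of \<open>a\<close>, also the t-derivatives of t times the coefficients at
    \<open>t *\<^sub>R p\<close>.\<close>
  define u where "u p t = a (t *\<^sub>R p) + t *\<^sub>R (eval_form (partial_x a (t *\<^sub>R p), partial_y a (t *\<^sub>R p)) p)" for p t
  define v where "v p t = b (t *\<^sub>R p) + t *\<^sub>R (eval_form (partial_y a (t *\<^sub>R p), partial_y b (t *\<^sub>R p)) p)" for p t
  have cont_comp: "continuous_on A (\<lambda>x. F (snd x *\<^sub>R fst x))"
    if "continuous_on UNIV F" for F :: "real \<times> real \<Rightarrow> complex" and A :: "((real \<times> real) \<times> real) set"
    by (rule continuous_on_compose2[OF that]) (auto intro!: continuous_intros)
  have cont_line: "continuous_on A (\<lambda>t. F (t *\<^sub>R p))"
    if "continuous_on UNIV F" for F :: "real \<times> real \<Rightarrow> complex" and A p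
    by (rule continuous_on_compose2[OF that]) (auto intro!: continuous_intros)
  have "((\<lambda>p. integral (cbox 0 1) (\<lambda>t. eval_form (a (t *\<^sub>R p), b (t *\<^sub>R p)) p)) has_derivative
      blinfun_apply (integral (cbox 0 1) (\<lambda>t. form_blinfun (u q t) (v q t)))) (at q within UNIV)"
  proof (rule leibniz_rule[where U = UNIV])
    fix p and t :: real
    show "((\<lambda>p. eval_form (a (t *\<^sub>R p), b (t *\<^sub>R p)) p) has_derivative
        blinfun_apply (form_blinfun (u p t) (v p t))) (at p within UNIV)"
      unfolding blinfun_apply_form_blinfun
    proof (rule has_derivative_eq_rhs)
      show "((\<lambda>p. eval_form (a (t *\<^sub>R p), b (t *\<^sub>R p)) p) has_derivative
          (\<lambda>h. (fst p *\<^sub>R eval_form (partial_x a (t *\<^sub>R p), partial_y a (t *\<^sub>R p)) (t *\<^sub>R h)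
              + fst h *\<^sub>R a (t *\<^sub>R p))
            + (snd p *\<^sub>R eval_form (partial_y a (t *\<^sub>R p), partial_y b (t *\<^sub>R p)) (t *\<^sub>R h)
              + snd h *\<^sub>R b (t *\<^sub>R p)))) (at p within UNIV)"
        unfolding eval_form_def[of "(a _, b _)"] fst_conv snd_conv
        by (intro derivative_intros comp[OF da] comp[OF db])
    qed (auto simp: eval_form_def u_def v_def fun_eq_iff algebra_simps)
  next
    fix p
    show "(\<lambda>t. eval_form (a (t *\<^sub>R p), b (t *\<^sub>R p)) p) integrable_on cbox 0 (1::real)"
      unfolding eval_form_def fst_conv snd_conv
      by (intro integrable_continuous continuous_intros cont_line conta contb)
  next
    show "continuous_on (UNIV \<times> cbox 0 (1::real)) (\<lambda>(p, t). form_blinfun (u p t) (v p t))"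
      unfolding form_blinfun_def u_def v_def eval_form_def split_beta fst_conv snd_conv
      by (intro continuous_intros cont_comp conta contb cont
          bounded_linear.continuous_on[OF bounded_linear_blinfun_scaleR_left])
  qed auto
  moreover have "blinfun_apply (integral (cbox 0 1) (\<lambda>t. form_blinfun (u q t) (v q t))) =
      eval_form (a q, b q)"
  proof
    fix h
    have "(\<lambda>t. form_blinfun (u q t) (v q t)) integrable_on (cbox 0 (1::real))"
      unfolding form_blinfun_def u_def v_def eval_form_def fst_conv snd_conv
      by (intro integrable_continuous continuous_intros cont_line conta contb cont
          bounded_linear.continuous_on[OF bounded_linear_blinfun_scaleR_left])
    then have "((\<lambda>t. form_blinfun (u q t) (v q t)) has_integral
        integral (cbox 0 1) (\<lambda>t. form_blinfun (u q t) (v q t))) (cbox 0 (1::real))"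
      by (rule integrable_integral)
    from has_integral_linear[OF this, of "\<lambda>L. blinfun_apply L h"]
    have "((\<lambda>t. eval_form (u q t, v q t) h) has_integral
        blinfun_apply (integral (cbox 0 1) (\<lambda>t. form_blinfun (u q t) (v q t))) h) {0..1}"
      by (simp add: o_def blinfun_apply_form_blinfun blinfun.bounded_linear_left)
    moreover have "((\<lambda>t. eval_form (u q t, v q t) h) has_integral
        1 *\<^sub>R eval_form (a (1 *\<^sub>R q), b (1 *\<^sub>R q)) h - 0 *\<^sub>R eval_form (a (0 *\<^sub>R q), b (0 *\<^sub>R q)) h) {0..1}"
    proof (rule fundamental_theorem_of_calculus)
      fix t :: real
      show "((\<lambda>t. t *\<^sub>R eval_form (a (t *\<^sub>R q), b (t *\<^sub>R q)) h) has_vector_derivative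
          eval_form (u q t, v q t) h) (at t within {0..1})"
      proof (rule has_vector_derivative_at_within)
        have *: "((\<lambda>t. a (t *\<^sub>R q)) has_vector_derivative
              eval_form (partial_x a (t *\<^sub>R q), partial_y a (t *\<^sub>R q)) q) (at t)"
            "((\<lambda>t. b (t *\<^sub>R q)) has_vector_derivative
              eval_form (partial_y a (t *\<^sub>R q), partial_y b (t *\<^sub>R q)) q) (at t)"
          by (rule comp_t[OF da], rule comp_t[OF db])
        have "((\<lambda>t. fst h *\<^sub>R a (t *\<^sub>R q)) has_vector_derivative
              fst h *\<^sub>R eval_form (partial_x a (t *\<^sub>R q), partial_y a (t *\<^sub>R q)) q) (at t)"
            "((\<lambda>t. snd h *\<^sub>R b (t *\<^sub>R q)) has_vector_derivative
              snd h *\<^sub>R eval_form (partial_y a (t *\<^sub>R q), partial_y b (t *\<^sub>R q)) q) (at t)"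
          by (rule bounded_linear.has_vector_derivative[OF bounded_linear_scaleR_right *(1)],
              rule bounded_linear.has_vector_derivative[OF bounded_linear_scaleR_right *(2)])
        from has_vector_derivative_add[OF this]
        have "((\<lambda>t. eval_form (a (t *\<^sub>R q), b (t *\<^sub>R q)) h) has_vector_derivative
            fst h *\<^sub>R eval_form (partial_x a (t *\<^sub>R q), partial_y a (t *\<^sub>R q)) q
            + snd h *\<^sub>R eval_form (partial_y a (t *\<^sub>R q), partial_y b (t *\<^sub>R q)) q) (at t)"
          by (simp only: eval_form_def fst_conv snd_conv)
        from has_vector_derivative_scaleR[OF DERIV_ident this]
        show "((\<lambda>t. t *\<^sub>R eval_form (a (t *\<^sub>R q), b (t *\<^sub>R q)) h) has_vector_derivative
            eval_form (u q t, v q t) h) (at t)"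
          by (rule has_vector_derivative_eq_rhs) (simp add: eval_form_def u_def v_def algebra_simps)
      qed
    qed simp
    ultimately show "blinfun_apply (integral (cbox 0 1) (\<lambda>t. form_blinfun (u q t) (v q t))) h =
        eval_form (a q, b q) h"
      by (auto dest: has_integral_unique)
  qed
  ultimately show ?thesis
    by (simp add: primitive_eq_integral[abs_def])
qed

section \<open>The torus\<close>

lemma Ck_holder_imp_continuous_on: "Ck_holder k \<alpha> U f \<Longrightarrow> continuous_on U f"
  by (cases k)
    (auto intro!: continuous_at_imp_continuous_on differentiable_imp_continuous_within)

lemma C_torus_ge_1D:
  assumes "C_torus s U f" "s \<ge> 1"
  shows "\<And>q. \<Pi> q \<in> U \<Longrightarrow> (f \<circ> \<Pi>) differentiable at q"
    "continuous_on (\<Pi> -` U) (partial_x (f \<circ> \<Pi>))" "continuous_on (\<Pi> -` U) (partial_y (f \<circ> \<Pi>))"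
proof -
  obtain k where "nat \<lfloor>s\<rfloor> = Suc k" using assms(2) by (cases "nat \<lfloor>s\<rfloor>") auto
  then have "Ck_holder (Suc k) (frac s) (\<Pi> -` U) (f \<circ> \<Pi>)" using assms(1) by (simp add: C_torus_def)
  then show "\<And>q. \<Pi> q \<in> U \<Longrightarrow> (f \<circ> \<Pi>) differentiable at q"
    "continuous_on (\<Pi> -` U) (partial_x (f \<circ> \<Pi>))" "continuous_on (\<Pi> -` U) (partial_y (f \<circ> \<Pi>))"
    by (auto dest: Ck_holder_imp_continuous_on)
qed

lemma covering_proj_eq_iff: "\<Pi> p = \<Pi> q \<longleftrightarrow> p - q \<in> \<int> \<times> \<int>"
  by (simp add: covering_proj_def torus.abs_eq_iff lattice_rel_def)

text \<open>Two points of such a ball are less than 1 apart, so integer coordinate differences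
  vanish.\<close>

lemma inj_on_covering_proj_ball: "inj_on \<Pi> (ball p (1/2))"
proof (rule inj_onI)
  fix x y assume xy: "x \<in> ball p (1/2)" "y \<in> ball p (1/2)" "\<Pi> x = \<Pi> y"
  have "dist x y < 1" using xy(1,2) dist_triangle_half_r[of p x 1 y] by simp
  then have "\<bar>fst x - fst y\<bar> < 1" "\<bar>snd x - snd y\<bar> < 1"
    using dist_fst_le[of x y] dist_snd_le[of x y] by (auto simp: dist_real_def)
  moreover have "fst x - fst y \<in> \<int>" "snd x - snd y \<in> \<int>"
    using xy(3) by (simp_all add: covering_proj_eq_iff mem_Times_iff)
  ultimately have "fst x - fst y = 0" "snd x - snd y = 0" using Ints_nonzero_abs_less1 by blast+
  then show "x = y" by (simp add: prod_eq_iff)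
qed

text \<open>The difference of \<open>f\<close> and its translate has zero derivative on a convex
  domain. For the primitive and a lattice vector \<open>v\<close>, the constant is the period of the
  form along the corresponding loop.\<close>

lemma periodic_derivative_imp_quasiperiodic:
  fixes f :: "'a::real_normed_vector \<Rightarrow> 'b::real_normed_vector"
  assumes "\<And>q. (f has_derivative f' q) (at q)" and "\<And>q. f' (q + v) = f' q"
  shows "\<exists>c. \<forall>q. f (q + v) = f q + c"
proof -
  have "((\<lambda>q. f (q + v) - f q) has_derivative (\<lambda>h. 0)) (at q within UNIV)" for q
  proof -
    have "((\<lambda>q. q + v) has_derivative (\<lambda>h. h)) (at q)" by (auto intro!: derivative_eq_intros)
    from has_derivative_diff[OF has_derivative_compose[OF this assms(1)] assms(1)]
    show ?thesis by (simp add: assms(2))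
  qed
  from has_derivative_zero_constant[OF convex_UNIV this]
  obtain c where c: "f (q + v) - f q = c" for q by auto
  have "f (q + v) = f q + c" for q using c[of q] by (simp add: algebra_simps)
  then show ?thesis by blast
qed

theorem proposition2p1:
  fixes a b :: "torus \<Rightarrow> complex" and \<omega> :: "torus one_form" and \<epsilon> :: real
  assumes eps: "\<epsilon> > 0"
    and form: "\<omega> = (\<lambda>p. (a p, b p))"
    and regular: "C_torus (1 + \<epsilon>) UNIV a" "C_torus (1 + \<epsilon>) UNIV b"
    and nonvanishing: "\<forall>p. \<omega> p \<noteq> (0, 0)"
    and closed: "closed_form (pullback \<omega>)"
    and curve: "embedded_curve (degeneracy_set \<omega>)"
    and finitely_many_components: "finite (components (degeneracy_set \<omega>))"
    and order: "\<forall>S \<in> components (degeneracy_set \<omega>). \<exists>\<sigma>>0. vanishes_to_order \<omega> S \<sigma>"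
    and hypocomplex: "hypocomplex (1 + \<epsilon>) \<omega>"
  shows "\<exists>W. homeomorphism UNIV UNIV (primitive (pullback \<omega>)) W"
proof -
  let ?a = "a \<circ> \<Pi>" and ?b = "b \<circ> \<Pi>" and ?Z = "primitive (pullback \<omega>)"
  have ge1: "1 + \<epsilon> \<ge> 1" using eps by simp
  have pb: "pullback \<omega> = (\<lambda>q. (?a q, ?b q))" by (auto simp: pullback_def form)
  note reg_a = C_torus_ge_1D[OF regular(1) ge1, simplified]
  note reg_b = C_torus_ge_1D[OF regular(2) ge1, simplified]
  have dZ: "(?Z has_derivative eval_form (?a q, ?b q)) (at q)" for q
    unfolding pb by (rule closed_form_primitive_has_derivative) (fact reg_a reg_b closed[unfolded pb])+
  show ?thesis
  proof (rule quasiperiodic_local_homeo_imp_homeomorphism)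
    show "continuous_on UNIV ?Z"
      using dZ by (meson continuous_at_imp_continuous_on has_derivative_continuous)
    show "\<exists>c. \<forall>q. ?Z (q + (of_int m, of_int n)) = ?Z q + c" for m n :: int
    proof (rule periodic_derivative_imp_quasiperiodic[OF dZ])
      show "eval_form (?a (q + (of_int m, of_int n)), ?b (q + (of_int m, of_int n))) = eval_form (?a q, ?b q)" for q
      proof -
        have "\<Pi> (q + (of_int m, of_int n)) = \<Pi> q" by (simp add: covering_proj_eq_iff)
        then show ?thesis by simp
      qed
    qed
    fix p :: "real \<times> real"
    obtain U \<zeta> \<xi> where U: "open U" "\<Pi> p \<in> U" and fi: "first_integral (1 + \<epsilon>) \<omega> U \<zeta>"
      and hom: "homeomorphism U (\<zeta> ` U) \<zeta> \<xi>"
      using hypocomplex unfolding hypocomplex_def by metis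
    have C: "C_torus (1 + \<epsilon>) U \<zeta>" using fi by (simp add: first_integral_def)
    note reg = C_torus_ge_1D[OF C ge1]
    \<comment> \<open>The first integral is injective on the torus only; its lift stays injective
      once the neighbourhood contains no two points that differ by a lattice vector.\<close>
    define V where "V = \<Pi> -` U \<inter> ball p (1/2)"
    have oU: "open (\<Pi> -` U)" using U by (simp add: open_torus_def)
    show "\<exists>V. open V \<and> p \<in> V \<and> inj_on ?Z V"
    proof (rule proportional_forms_inj[of V p "\<zeta> \<circ> \<Pi>" "partial_x (\<zeta> \<circ> \<Pi>)" "partial_y (\<zeta> \<circ> \<Pi>)" ?Z ?a ?b])
      show "open V" using oU by (auto simp: V_def)
      show "p \<in> V" using U by (auto simp: V_def)
      have "inj_on \<zeta> U" using hom by (metis homeomorphism_apply1 inj_on_inverseI)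
      then show "inj_on (\<zeta> \<circ> \<Pi>) V"
        using inj_on_covering_proj_ball[of p]
        by (intro comp_inj_on) (auto simp: V_def elim: inj_on_subset)
      show "(\<zeta> \<circ> \<Pi> has_derivative eval_form (partial_x (\<zeta> \<circ> \<Pi>) q, partial_y (\<zeta> \<circ> \<Pi>) q)) (at q)"
        if "q \<in> V" for q
        using has_derivative_differential[OF reg(1), of q] that by (simp add: V_def differential_def)
      show "isCont (partial_x (\<zeta> \<circ> \<Pi>)) p" "isCont (partial_y (\<zeta> \<circ> \<Pi>)) p"
        using reg(2,3) oU U by (auto simp: continuous_on_eq_continuous_at)
      show "isCont ?a p" "isCont ?b p"
        using reg_a(1) reg_b(1) by (blast intro: differentiable_imp_continuous_within)+
      show "(partial_x (\<zeta> \<circ> \<Pi>) p, partial_y (\<zeta> \<circ> \<Pi>) p) \<noteq> (0, 0)"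
        using fi U unfolding first_integral_def differential_def by blast
      show "(?a p, ?b p) \<noteq> (0, 0)" using nonvanishing by (simp add: form)
      \<comment> \<open>In coordinates, a vanishing wedge product is exactly the proportionality of
        d\<zeta> and dZ.\<close>
      show "partial_x (\<zeta> \<circ> \<Pi>) q * ?b q = partial_y (\<zeta> \<circ> \<Pi>) q * ?a q" if "q \<in> V" for q
      proof -
        have "wedge (differential (\<zeta> \<circ> \<Pi>) q) (pullback \<omega> q) = 0"
          using fi that unfolding first_integral_def V_def by blast
        then show ?thesis by (simp add: wedge_def differential_def pb mult.commute)
      qed
    qed (rule dZ)
  qed
qed

end
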